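(* Let the stochastic game be as described in the context, let $\theta_1,\dots,\theta_N$ be real numbers, fix $V\ge 0$, and let $\{\omega(t)\}_{t\ge 0}$ in $\Omega$ and $\{b(t)\}_{t\ge 0}$ in $\mathcal{A}_1\times\cdots\times\mathcal{A}_N$ be arbitrary sequences. Suppose that $\{\alpha(t)\}_{t\ge 0}$ and $\{Q(t)\}_{t\ge 0}$ are generated by the weighted-sum algorithm (described in the context) with this $V$ and with $Q_i(0)=0$ for all $i\in\{1,\dots,N\}$. Let $B=\frac12\sum_{i=1}^N (u_i^{max})^2$. Then for all $t\in\{1,2,3,\dots\}$: (a) $\displaystyle \frac{\|Q(t)\|}{t}\le \sqrt{\frac{2B+2V\sum_{i=1}^N|\theta_i|u_i^{max}}{t}}$. (b) $\displaystyle \overline{u}_i(t)-\overline{x}_i(t)\ge -\sqrt{\frac{2B+2V\sum_{j=1}^N|\theta_j|u_j^{max}}{t}}$ for all $i\in\{1,\dots,N\}$. Moreover: (c) $\liminf_{t\to\infty}[\overline{u}_i(t)-\overline{x}_i(t)]\ge 0$ for all $i\in\{1,\dots,N\}$, and $\alpha_i(t)\in\mathcal{A}_i$ for all $i\in\{1,\dots,N\}$ and all $t\in\{0,1,2,\dots\}$.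
   Context: Game. $N\ge 2$ is an integer (number of players). $\Omega$ and $\mathcal{A}_1,\dots,\mathcal{A}_N$ are arbitrary nonempty sets (event set and action sets). For each $i$, $\hat{u}_i:\mathcal{A}_1\times\cdots\times\mathcal{A}_N\times\Omega\to\mathbb{R}$ is a utility function with $0\le \hat{u}_i(\alpha,\omega)\le u_i^{max}$ for all $(\alpha,\omega)$, where $u_i^{max}<\infty$. It is assumed that for every $\omega\in\Omega$ and all real $\beta_1,\dots,\beta_N$, the supremum of $\sum_{i=1}^N\beta_i\hat{u}_i(\alpha,\omega)$ over $\alpha\in\mathcal{A}_1\times\cdots\times\mathcal{A}_N$ is attained. Sequences. $\omega(t)$ is the event vector and $b(t)=(b_1(t),\dots,b_N(t))$ the vector of baseline actions on round $t\in\{0,1,2,\dots\}$. For an action sequence $\alpha(t)=(\alpha_1(t),\dots,\alpha_N(t))$ define $u_i(t)=\hat{u}_i(\alpha(t),\omega(t))$, $x_i(t)=\hat{u}_i(b(t),\omega(t))$, and for $t\geq 1$, $\overline{u}_i(t)=\frac1t\sum_{\tau=0}^{t-1}u_i(\tau)$, $\overline{x}_i(t)=\frac1t\sum_{\tau=0}^{t-1}x_i(\tau)$. Weighted-sum algorithm with parameter $V$ and weights $\theta_i$. It maintains $Q(t)=(Q_1(t),\dots,Q_N(t))$. On every round $t\in\{0,1,2,\dots\}$: (1) choose $\alpha(t)\in\mathcal{A}_1\times\cdots\times\mathcal{A}_N$ as a maximizer of $\sum_{i=1}^N\hat{u}_i(\alpha,\omega(t))[V\theta_i+Q_i(t)]$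 over $\alpha\in\mathcal{A}_1\times\cdots\times\mathcal{A}_N$ (any maximizer); (2) update $Q_i(t+1)=\max[Q_i(t)+x_i(t)-u_i(t),0]$ for each $i$. $\|\cdot\|$ is the Euclidean norm. *)

theory Defs
  imports "HOL-Analysis.Analysis"
begin

text \<open>
  Players are the elements of a finite index type \<open>'n\<close>, so the number of players is
  \<open>CARD('n)\<close>. The action sets \<open>A i\<close> may differ from player to player; they are subsets of
  one common type \<open>'a\<close>, which is no restriction, as any family of sets embeds into its
  disjoint union. Utilities are constrained only on \<open>profiles A \<times> \<Omega>\<close>.
\<close>

definition profiles :: "('n \<Rightarrow> 'a set) \<Rightarrow> ('n \<Rightarrow> 'a) set" where
  "profiles A = (\<Pi>\<^sub>E i\<in>UNIV. A i)"

locale stochastic_game =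
  fixes \<Omega> :: "'w set"
    and A :: "'n::finite \<Rightarrow> 'a set"
    and util :: "'n \<Rightarrow> ('n \<Rightarrow> 'a) \<Rightarrow> 'w \<Rightarrow> real"
    and umax :: "'n \<Rightarrow> real"
  assumes players: "CARD('n) \<ge> 2"
    and events_nonempty: "\<Omega> \<noteq> {}"
    and actions_nonempty: "\<And>i. A i \<noteq> {}"
    and util_nonneg: "\<And>i a w. a \<in> profiles A \<Longrightarrow> w \<in> \<Omega> \<Longrightarrow> 0 \<le> util i a w"
    and util_le: "\<And>i a w. a \<in> profiles A \<Longrightarrow> w \<in> \<Omega> \<Longrightarrow> util i a w \<le> umax i"
    and sup_attained: "\<And>w (\<beta> :: 'n \<Rightarrow> real). w \<in> \<Omega> \<Longrightarrow>
      \<exists>a. is_arg_max (\<lambda>a. \<Sum>i\<in>UNIV. \<beta> i * util i a w) (\<lambda>a. a \<in> profiles A) a"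

text \<open>
  The sequences \<open>\<alpha>\<close> and \<open>Q\<close> form a run of the algorithm for the events \<open>\<omega>\<close> and the baseline
  actions \<open>b\<close>. The maximizer is arbitrary, and the initial value \<open>Q 0\<close> is left open.
\<close>

definition weighted_sum_algorithm ::
  "('n::finite \<Rightarrow> 'a set) \<Rightarrow> ('n \<Rightarrow> ('n \<Rightarrow> 'a) \<Rightarrow> 'w \<Rightarrow> real) \<Rightarrow> real \<Rightarrow> ('n \<Rightarrow> real) \<Rightarrow>
   (nat \<Rightarrow> 'w) \<Rightarrow> (nat \<Rightarrow> 'n \<Rightarrow> 'a) \<Rightarrow> (nat \<Rightarrow> 'n \<Rightarrow> 'a) \<Rightarrow> (nat \<Rightarrow> real ^ 'n) \<Rightarrow> bool" where
  "weighted_sum_algorithm A util V \<theta> \<omega> b \<alpha> Q \<longleftrightarrow>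
     (\<forall>t. is_arg_max (\<lambda>a. \<Sum>i\<in>UNIV. util i a (\<omega> t) * (V * \<theta> i + Q t $ i))
            (\<lambda>a. a \<in> profiles A) (\<alpha> t) \<and>
          (\<forall>i. Q (Suc t) $ i =
             max (Q t $ i + util i (b t) (\<omega> t) - util i (\<alpha> t) (\<omega> t)) 0))"

text \<open>Meaningful for \<open>t \<ge> 1\<close> only; at \<open>t = 0\<close> it is \<open>0\<close> by division by zero.\<close>

definition avg_util ::
  "('n \<Rightarrow> ('n \<Rightarrow> 'a) \<Rightarrow> 'w \<Rightarrow> real) \<Rightarrow> (nat \<Rightarrow> 'w) \<Rightarrow> (nat \<Rightarrow> 'n \<Rightarrow> 'a) \<Rightarrow> 'n \<Rightarrow> nat \<Rightarrow> real" where
  "avg_util util \<omega> a i t = (1 / real t) * (\<Sum>\<tau><t. util i (a \<tau>) (\<omega> \<tau>))"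

end

theory Submission
  imports Defs
begin

text \<open>
  The drift argument: since \<open>(max y 0)\<^sup>2 \<le> y\<^sup>2\<close>, one round increases \<open>\<parallel>Q\<parallel>\<^sup>2\<close> by at most
  \<open>\<Sum>i. (x\<^sub>i - u\<^sub>i)\<^sup>2 + 2 \<Sum>i. Q\<^sub>i (x\<^sub>i - u\<^sub>i)\<close>. Comparing the maximizer with the baseline action
  bounds the last sum by \<open>V \<Sum>i. \<theta>\<^sub>i (u\<^sub>i - x\<^sub>i)\<close>, so the increase is bounded by a constant \<open>C\<close> and
  \<open>\<parallel>Q(t)\<parallel>\<^sup>2 \<le> C t\<close>. Moreover \<open>Q\<^sub>i(t)\<close> dominates the accumulated shortfall of \<open>u\<^sub>i\<close> against \<open>x\<^sub>i\<close>.
\<close>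

lemma norm_max_update_le:
  fixes q q' :: "real ^ 'n" and d :: "'n::finite \<Rightarrow> real"
  assumes upd: "\<And>i. q' $ i = max (q $ i + d i) 0"
  shows "(norm q')\<^sup>2 \<le> (norm q)\<^sup>2 + (\<Sum>i\<in>UNIV. (d i)\<^sup>2) + 2 * (\<Sum>i\<in>UNIV. q $ i * d i)"
proof -
  have sq: "(norm v)\<^sup>2 = (\<Sum>i\<in>UNIV. (v $ i)\<^sup>2)" for v :: "real ^ 'n"
    by (simp add: norm_vec_def L2_set_def sum_nonneg)
  have "(norm q')\<^sup>2 \<le> (\<Sum>i\<in>UNIV. (q $ i + d i)\<^sup>2)"
    unfolding sq by (intro sum_mono) (simp add: upd max_def)
  also have "\<dots> = (norm q)\<^sup>2 + (\<Sum>i\<in>UNIV. (d i)\<^sup>2) + 2 * (\<Sum>i\<in>UNIV. q $ i * d i)"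
    unfolding sq by (simp add: power2_sum sum.distrib sum_distrib_left mult.assoc)
  finally show ?thesis .
qed

text \<open>Truncation at zero only raises the queue, so each round adds at least \<open>d t\<close>
  to \<open>q\<close>, and the increments telescope from \<open>q 0 = 0\<close>.\<close>

lemma sum_le_max_queue:
  fixes q d :: "nat \<Rightarrow> real"
  assumes "q 0 = 0" and "\<And>t. q (Suc t) = max (q t + d t) 0"
  shows "(\<Sum>\<tau><t. d \<tau>) \<le> q t"
  by (induction t) (use assms in \<open>auto simp: max_def\<close>)

lemma Liminf_ge_0_if_ge_neg_sqrt:
  fixes f :: "nat \<Rightarrow> real"
  assumes "\<And>t. t \<ge> 1 \<Longrightarrow> f t \<ge> - sqrt (C / real t)"
  shows "liminf (\<lambda>t. ereal (f t)) \<ge> 0"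
proof -
  have "(\<lambda>t. - sqrt (C / real t)) \<longlonglongrightarrow> 0"
    using tendsto_minus[OF tendsto_real_sqrt[OF lim_const_over_n[of C]]] by simp
  then have "liminf (\<lambda>t. ereal (- sqrt (C / real t))) = 0"
    by (intro lim_imp_Liminf) (auto simp: zero_ereal_def)
  moreover have "liminf (\<lambda>t. ereal (- sqrt (C / real t))) \<le> liminf (\<lambda>t. ereal (f t))"
    \<comment> \<open>The bound is assumed from index 1 on only, which suffices for a limit
      inferior.\<close>
    by (intro Liminf_mono) (use assms in \<open>auto intro: eventually_sequentiallyI[of 1]\<close>)
  ultimately show ?thesis by simp
qed

context stochastic_game
begin

text \<open>Both values lie in the interval from 0 to \<open>umax i\<close>, so the bound is its
  length and not twice that; this fixes the constants in the theorem.\<close>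

lemma abs_util_diff_le:
  assumes "a \<in> profiles A" "a' \<in> profiles A" "w \<in> \<Omega>"
  shows "\<bar>util i a w - util i a' w\<bar> \<le> umax i"
  using util_nonneg[of a w i] util_nonneg[of a' w i] util_le[of a w i] util_le[of a' w i] assms
  by linarith

lemma maximizer_drift_le:
  assumes V: "V \<ge> 0" and w: "w \<in> \<Omega>" and b: "b \<in> profiles A"
    and max: "is_arg_max (\<lambda>a. \<Sum>i\<in>UNIV. util i a w * (V * \<theta> i + q i)) (\<lambda>a. a \<in> profiles A) a"
  shows "(\<Sum>i\<in>UNIV. q i * (util i b w - util i a w)) \<le> V * (\<Sum>i\<in>UNIV. \<bar>\<theta> i\<bar> * umax i)"
proof -
  have a: "a \<in> profiles A"
    using max by (simp add: is_arg_max_def)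
  have "(\<Sum>i\<in>UNIV. util i b w * (V * \<theta> i + q i)) \<le> (\<Sum>i\<in>UNIV. util i a w * (V * \<theta> i + q i))"
    using max b by (auto simp: is_arg_max_linorder)
  \<comment> \<open>Splitting the weights into \<open>V * \<theta> i\<close> and \<open>q i\<close>
    keeps the queue part on the left; the other part changes sides, which swaps \<open>a\<close> and
    \<open>b\<close> in the difference.\<close>
  then have "(\<Sum>i\<in>UNIV. q i * (util i b w - util i a w))
      \<le> (\<Sum>i\<in>UNIV. V * (\<theta> i * (util i a w - util i b w)))"
    by (simp add: algebra_simps sum.distrib sum_subtractf)
  also have "\<dots> \<le> (\<Sum>i\<in>UNIV. V * (\<bar>\<theta> i\<bar> * umax i))"
  proof (intro sum_mono mult_left_mono V)
    fix i
    \<comment> \<open>Both factors may be negative, hence the absolute values.\<close>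
    have "\<theta> i * (util i a w - util i b w) \<le> \<bar>\<theta> i\<bar> * \<bar>util i a w - util i b w\<bar>"
      by (metis abs_ge_self abs_mult)
    also have "\<dots> \<le> \<bar>\<theta> i\<bar> * umax i"
      by (intro mult_left_mono abs_util_diff_le a b w) simp
    finally show "\<theta> i * (util i a w - util i b w) \<le> \<bar>\<theta> i\<bar> * umax i" .
  qed
  finally show ?thesis
    by (simp add: sum_distrib_left)
qed

lemma norm_queue_le:
  assumes V: "V \<ge> 0" and events: "\<And>t. \<omega> t \<in> \<Omega>" and baselines: "\<And>t. b t \<in> profiles A"
    and algorithm: "weighted_sum_algorithm A util V \<theta> \<omega> b \<alpha> Q"
    and Q_init: "Q 0 = 0"
  shows "(norm (Q t))\<^sup>2
    \<le> real t * ((\<Sum>i\<in>UNIV. (umax i)\<^sup>2) + 2 * V * (\<Sum>i\<in>UNIV. \<bar>\<theta> i\<bar> * umax i))"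
proof (induction t)
  case 0
  then show ?case by (simp add: Q_init)
next
  case (Suc t)
  define d where "d i = util i (b t) (\<omega> t) - util i (\<alpha> t) (\<omega> t)" for i
  have max: "is_arg_max (\<lambda>a. \<Sum>i\<in>UNIV. util i a (\<omega> t) * (V * \<theta> i + Q t $ i))
      (\<lambda>a. a \<in> profiles A) (\<alpha> t)"
    and upd: "Q (Suc t) $ i = max (Q t $ i + d i) 0" for i
    using algorithm by (simp_all add: weighted_sum_algorithm_def d_def add_diff_eq)
  have "\<bar>d i\<bar> \<le> umax i" for i
    unfolding d_def using max by (intro abs_util_diff_le baselines events) (simp add: is_arg_max_def)
  then have "(\<Sum>i\<in>UNIV. (d i)\<^sup>2) \<le> (\<Sum>i\<in>UNIV. (umax i)\<^sup>2)"
    by (intro sum_mono) (meson abs_ge_zero order_trans power2_le_iff_abs_le)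
  moreover have "(\<Sum>i\<in>UNIV. Q t $ i * d i) \<le> V * (\<Sum>i\<in>UNIV. \<bar>\<theta> i\<bar> * umax i)"
    unfolding d_def by (rule maximizer_drift_le[OF V events baselines max])
  \<comment> \<open>The bound on the increase is the same in every round, so it raises the factor
    \<open>real t\<close> by one.\<close>
  ultimately show ?case
    using norm_max_update_le[of "Q (Suc t)" "Q t" d, OF upd] Suc.IH
    by (simp add: algebra_simps)
qed

end

theorem theorem1:
  fixes \<Omega> :: "'w set"
    and A :: "'n::finite \<Rightarrow> 'a set"
    and util :: "'n \<Rightarrow> ('n \<Rightarrow> 'a) \<Rightarrow> 'w \<Rightarrow> real"
    and umax :: "'n \<Rightarrow> real"
    and \<theta> :: "'n \<Rightarrow> real"
    and V B :: real
    and \<omega> :: "nat \<Rightarrow> 'w"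
    and b \<alpha> :: "nat \<Rightarrow> 'n \<Rightarrow> 'a"
    and Q :: "nat \<Rightarrow> real ^ 'n"
  assumes game: "stochastic_game \<Omega> A util umax"
    and V_nonneg: "V \<ge> 0"
    and events: "\<And>t. \<omega> t \<in> \<Omega>"
    and baselines: "\<And>t. b t \<in> profiles A"
    and algorithm: "weighted_sum_algorithm A util V \<theta> \<omega> b \<alpha> Q"
    and Q_init: "\<And>i. Q 0 $ i = 0"
    and B_eq: "B = (1 / 2) * (\<Sum>i\<in>UNIV. (umax i)\<^sup>2)"
  shows "(\<forall>t\<ge>1. norm (Q t) / real t
            \<le> sqrt ((2 * B + 2 * V * (\<Sum>i\<in>UNIV. \<bar>\<theta> i\<bar> * umax i)) / real t))
       \<and> (\<forall>t\<ge>1. \<forall>i. avg_util util \<omega> \<alpha> i t - avg_util util \<omega> b i t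
            \<ge> - sqrt ((2 * B + 2 * V * (\<Sum>j\<in>UNIV. \<bar>\<theta> j\<bar> * umax j)) / real t))
       \<and> (\<forall>i. liminf (\<lambda>t. ereal (avg_util util \<omega> \<alpha> i t - avg_util util \<omega> b i t)) \<ge> 0)
       \<and> (\<forall>i t. \<alpha> t i \<in> A i)"
proof -
  interpret stochastic_game \<Omega> A util umax by (rule game)
  \<comment> \<open>Since \<open>2 * B\<close> is the sum of the squares of \<open>umax i\<close>,
    \<open>C\<close> is exactly the growth rate in \<open>norm_queue_le\<close>.\<close>
  define C where "C = 2 * B + 2 * V * (\<Sum>i\<in>UNIV. \<bar>\<theta> i\<bar> * umax i)"
  have Q0: "Q 0 = 0"
    using Q_init by (simp add: vec_eq_iff)
  have norm_le: "norm (Q t) / real t \<le> sqrt (C / real t)" if "t \<ge> 1" for t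
  \<comment> \<open>After squaring, the claim is the linear bound on the squared norm divided by the
    square of \<open>t\<close>.\<close>
  proof (rule real_le_rsqrt)
    have "(norm (Q t))\<^sup>2 \<le> real t * C"
      using norm_queue_le[OF V_nonneg events baselines algorithm Q0, of t] by (simp add: C_def B_eq)
    then show "(norm (Q t) / real t)\<^sup>2 \<le> C / real t"
      using that by (simp add: field_simps power2_eq_square)
  qed
  have avg_ge: "avg_util util \<omega> \<alpha> i t - avg_util util \<omega> b i t \<ge> - sqrt (C / real t)"
    if "t \<ge> 1" for i t
  proof -
    have "(\<Sum>\<tau><t. util i (b \<tau>) (\<omega> \<tau>) - util i (\<alpha> \<tau>) (\<omega> \<tau>)) \<le> Q t $ i"
      using algorithm
      by (intro sum_le_max_queue Q_init) (simp add: weighted_sum_algorithm_def add_diff_eq)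
    \<comment> \<open>Passing from one coordinate to the norm lets the first bound imply the
      second.\<close>
    also have "\<dots> \<le> norm (Q t)"
      using component_le_norm_cart[of "Q t" i] by linarith
    finally have "avg_util util \<omega> b i t - avg_util util \<omega> \<alpha> i t \<le> norm (Q t) / real t"
      using that by (simp add: avg_util_def sum_subtractf divide_right_mono flip: diff_divide_distrib)
    with norm_le[OF that] show ?thesis by linarith
  qed
  \<comment> \<open>Feasibility of the maximizer is part of \<open>is_arg_max\<close>.\<close>
  have "\<alpha> t \<in> profiles A" for t
    using algorithm by (simp add: weighted_sum_algorithm_def is_arg_max_def)
  then have "\<alpha> t i \<in> A i" for i t
    by (auto simp: profiles_def)
  moreover have "liminf (\<lambda>t. ereal (avg_util util \<omega> \<alpha> i t - avg_util util \<omega> b i t)) \<ge> 0" for i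
    by (rule Liminf_ge_0_if_ge_neg_sqrt) (rule avg_ge)
  ultimately show ?thesis
    using norm_le avg_ge unfolding C_def by blast
qed

end
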